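(* Let $H=(V,E)$ be a connected hypergraph with sink $q$. Any two burning equivalent spanning trees of $B(H)$ give rise to the same hypertree.
   Context: A hypergraph $H=(V,E)$ consists of a finite vertex set $V$ and a set $E$ of nonempty subsets of $V$, called hyperedges. $H$ is connected if for any two vertices $v_1,v_2$ there is a sequence of hyperedges $(e_1,\dots,e_m)$ with $v_1\in e_1$, $v_2\in e_m$ and $e_i\cap e_{i+1}\neq\emptyset$ for all $i<m$. One vertex $q\in V$ is the sink. The bipartite incidence graph $B(H)$ has vertex set $L\sqcup R$ with $L=E$, $R=V$, and an edge between $e\in E$ and $v\in V$ whenever $v\in e$. Two spanning trees $T,T'$ of $B(H)$ are burning equivalent if, after orienting the edges of $T$ and of $T'$ towards the sink $q\in R$, the set of edges directed from $R$ to $L$ is the same for both. A hypertree in $H$ is a function $f:E\to\{0,1,2,\dots\}$ such that there exists a spanning tree of $B(H)$ having degree $f(e)+1$ at each $e\in E$. A spanning tree $T$ of $B(H)$ gives rise to the hypertree $f$ with $f(e)=\deg_T(e)-1$ if $\deg_T(e)>0$ and $f(e)=0$ if $\deg_T(e)=0$, where $\deg_T(e)$ is the degree of $e$ in the tree $T$. *)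

theory Defs
  imports "Graph_Theory.Graph_Theory" "HOL-Library.FuncSet"
begin

definition hypergraph :: "'v set \<Rightarrow> 'v set set \<Rightarrow> bool" where
  "hypergraph V E \<longleftrightarrow> finite V \<and> (\<forall>e\<in>E. e \<noteq> {} \<and> e \<subseteq> V)"

text \<open>
  The condition is imposed on pairs of distinct vertices only, so that a single vertex
  without hyperedges counts as connected.
\<close>
definition connected_hypergraph :: "'v set \<Rightarrow> 'v set set \<Rightarrow> bool" where
  "connected_hypergraph V E \<longleftrightarrow> hypergraph V E \<and>
     (\<forall>v1\<in>V. \<forall>v2\<in>V. v1 \<noteq> v2 \<longrightarrow>
        (\<exists>es. es \<noteq> [] \<and> set es \<subseteq> E \<and> v1 \<in> hd es \<and> v2 \<in> last es \<and>
              (\<forall>i. Suc i < length es \<longrightarrow> es ! i \<inter> es ! Suc i \<noteq> {})))"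

text \<open>
  Undirected graphs are symmetric digraphs, as in the locale \<^locale>\<open>pair_graph\<close>: an
  undirected edge is a pair of opposite arcs. The class \<open>L\<close> of hyperedges is tagged
  by \<^const>\<open>Inl\<close>, the class \<open>R\<close> of vertices by \<^const>\<open>Inr\<close>.
\<close>
definition incidence_graph :: "'v set \<Rightarrow> 'v set set \<Rightarrow> ('v set + 'v) pair_pre_digraph" where
  "incidence_graph V E =
     \<lparr> pverts = Inl ` E \<union> Inr ` V,
       parcs = {(Inl e, Inr v) |e v. e \<in> E \<and> v \<in> V \<and> v \<in> e} \<union>
               {(Inr v, Inl e) |e v. e \<in> E \<and> v \<in> V \<and> v \<in> e} \<rparr>"

text \<open>
  The library constants \<^const>\<open>tree\<close> and \<^const>\<open>spanning_tree\<close> forbid all directed cycles.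
  They do not fit here: two opposite arcs form a directed cycle of length 2, and picking just
  one arc per edge would allow undirected cycles. In a loop-free symmetric digraph without
  multiple arcs, the undirected cycles are exactly the directed cycles of length at least 3.
\<close>
definition undirected_tree :: "'a pair_pre_digraph \<Rightarrow> bool" where
  "undirected_tree T \<longleftrightarrow> pair_graph T \<and> Digraph_Component.connected (with_proj T) \<and>
     \<not> (\<exists>p. pre_digraph.cycle (with_proj T) p \<and> 3 \<le> length p)"

definition undirected_spanning_tree :: "'a pair_pre_digraph \<Rightarrow> 'a pair_pre_digraph \<Rightarrow> bool" where
  "undirected_spanning_tree T G \<longleftrightarrow> undirected_tree T \<and> spanning (with_proj T) (with_proj G)"

text \<open>In a symmetric digraph the out-degree is the number of undirected edges at a vertex.\<close>
definition degree :: "'a pair_pre_digraph \<Rightarrow> 'a \<Rightarrow> nat" where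
  "degree T x = out_degree (with_proj T) x"

text \<open>
  Orientation of a tree towards \<open>r\<close>: the edge between \<open>a\<close> and \<open>b\<close> is directed from \<open>a\<close> to \<open>b\<close>
  if it is the first edge of the path from \<open>a\<close> to \<open>r\<close>.
\<close>
definition oriented_towards :: "'a \<Rightarrow> 'a pair_pre_digraph \<Rightarrow> ('a \<times> 'a) set" where
  "oriented_towards r T =
     {(a, b). (a, b) \<in> parcs T \<and> (\<exists>p. pre_digraph.apath (with_proj T) a ((a, b) # p) r)}"

definition burning_equivalent ::
    "'v \<Rightarrow> ('v set + 'v) pair_pre_digraph \<Rightarrow> ('v set + 'v) pair_pre_digraph \<Rightarrow> bool" where
  "burning_equivalent q T T' \<longleftrightarrow>
     {(v, e). (Inr v, Inl e) \<in> oriented_towards (Inr q) T} =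
     {(v, e). (Inr v, Inl e) \<in> oriented_towards (Inr q) T'}"

text \<open>Functions on \<open>E\<close> are extensional functions, so that equality only concerns values on \<open>E\<close>.\<close>
definition hypertree :: "'v set \<Rightarrow> 'v set set \<Rightarrow> ('v set \<Rightarrow> nat) \<Rightarrow> bool" where
  "hypertree V E f \<longleftrightarrow> f \<in> extensional E \<and>
     (\<exists>T. undirected_spanning_tree T (incidence_graph V E) \<and>
          (\<forall>e\<in>E. degree T (Inl e) = f e + 1))"

definition induced_hypertree ::
    "'v set set \<Rightarrow> ('v set + 'v) pair_pre_digraph \<Rightarrow> 'v set \<Rightarrow> nat" where
  "induced_hypertree E T =
     (\<lambda>e\<in>E. if degree T (Inl e) > 0 then degree T (Inl e) - 1 else 0)"

end

theory Submission
  imports Defs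
begin

text \<open>
  Orient a spanning tree \<open>T\<close> towards the sink. Every node other than the sink is the tail of
  exactly one oriented edge, so all other edges at the node point into it, and the degree of a
  node that is not the sink is one more than the number of edges pointing into it
  (\<open>degree_eq_Suc_in_edges\<close>). A hyperedge is a node of \<open>L\<close>, hence never the sink, and the edges
  pointing into it all come from \<open>R\<close>. The value of the induced hypertree at a hyperedge is
  therefore the number of edges directed from \<open>R\<close> to \<open>L\<close> that end there, and burning equivalence
  says precisely that the set of these edges is the same for both trees.

  The facts about orientations all rest on one consequence of acyclicity
  (\<open>tree_no_bypass\<close>): two different neighbours of a node \<open>x\<close> cannot be joined by a walk avoiding
  \<open>x\<close>. It makes the first edge of the path from \<open>x\<close> to the root unique, and it forces each edge to
  be used by the path from one of its two ends.
\<close>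

text \<open>
  A walk from \<open>a\<close> to \<open>b\<close> avoiding \<open>x\<close>, shortened to a path, would close up through \<open>x\<close> to a cycle;
  as \<open>a \<noteq> b\<close>, this cycle has at least three arcs and is not a single edge passed in both directions.
\<close>
lemma (in pair_graph) tree_no_bypass:
  assumes tree: "undirected_tree G"
    and xa: "(x, a) \<in> parcs G" and xb: "(x, b) \<in> parcs G" and "a \<noteq> b"
    and p: "awalk a p b"
  shows "x \<in> set (awalk_verts a p)"
proof (rule ccontr)
  assume x: "x \<notin> set (awalk_verts a p)"
  define s where "s = awalk_to_apath p"
  have s: "apath a s b" and sub: "set s \<subseteq> set p"
    unfolding s_def using apath_awalk_to_apath[OF p] awalk_to_apath_subset[OF p] by auto
  from s have s': "awalk a s b" by (rule awalkI_apath)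
  have xs: "x \<notin> set (awalk_verts a s)"
    using x sub set_awalk_verts[OF s'] set_awalk_verts[OF p] by auto
  have "s \<noteq> []" using s \<open>a \<noteq> b\<close> by (auto simp: apath_Nil_iff)
  have bx: "(b, x) \<in> parcs G" using xb by (rule arcs_symmetric)
  let ?c = "(x, a) # s @ [(b, x)]"
  have last: "awlast a s = b" using s' by auto
  have walk: "awalk a (s @ [(b, x)]) x"
    using s' last bx by (auto simp: awalk_simps in_arcsD2)
  then have "awalk x ?c x" using xa unfolding awalk_Cons_iff by auto
  moreover have "distinct (tl (awalk_verts x ?c))"
    using awalk_verts_append[OF walk] last s xs by (auto simp: apath_def)
  ultimately have "cycle ?c" unfolding cycle_def by blast
  moreover have "3 \<le> length ?c" using \<open>s \<noteq> []\<close> by (cases s) auto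
  ultimately show False using tree unfolding undirected_tree_def by blast
qed

lemma (in pair_graph) tree_apath_exists:
  assumes "undirected_tree G" and "a \<in> pverts G" and "r \<in> pverts G"
  obtains p where "apath a p r"
proof -
  have "strongly_connected G"
    using assms(1) symmetric_connected_imp_strongly_connected[OF sym_arcs]
    by (auto simp: undirected_tree_def)
  then have "a \<rightarrow>\<^sup>*\<^bsub>with_proj G\<^esub> r" using assms(2,3) by (auto simp: strongly_connected_def)
  then show thesis using that by (auto simp: reachable_apath)
qed

text \<open>
  The tails of two paths from \<open>x\<close> to the root, the second one reversed, form a walk that avoids
  \<open>x\<close> and joins the two first steps.
\<close>
lemma (in pair_graph) oriented_towards_unique_head:
  assumes tree: "undirected_tree G"
    and a: "(x, a) \<in> oriented_towards r G" and b: "(x, b) \<in> oriented_towards r G"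
  shows "a = b"
proof (rule ccontr)
  assume "a \<noteq> b"
  obtain p where p: "apath x ((x, a) # p) r" using a by (auto simp: oriented_towards_def)
  obtain q where q: "apath x ((x, b) # q) r" using b by (auto simp: oriented_towards_def)
  have pw: "awalk a p r" "x \<notin> set (awalk_verts a p)"
    using p by (auto simp: apath_Cons_iff awalkI_apath)
  have qw: "awalk b q r" "x \<notin> set (awalk_verts b q)"
    using q by (auto simp: apath_Cons_iff awalkI_apath)
  have rq: "awalk r (rev_path q) b" using qw(1) by simp
  have "awalk a (p @ rev_path q) b" using pw(1) rq by (rule awalk_appendI)
  moreover have "x \<notin> set (awalk_verts a (p @ rev_path q))"
    using set_awalk_verts_append[OF pw(1) rq] awalk_verts_rev_path[OF qw(1)] pw(2) qw(2)
    by simp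
  ultimately show False
    using tree_no_bypass[OF tree _ _ \<open>a \<noteq> b\<close>] p q by (auto simp: apath_Cons_iff)
qed

lemma (in pair_graph) oriented_towards_exists_head:
  assumes "undirected_tree G" and "x \<in> pverts G" and "r \<in> pverts G" and "x \<noteq> r"
  obtains a where "(x, a) \<in> oriented_towards r G"
proof -
  obtain p where p: "apath x p r" using tree_apath_exists[OF assms(1-3)] by blast
  then obtain e p' where pe: "p = e # p'" using \<open>x \<noteq> r\<close> by (cases p) (auto simp: apath_Nil_iff)
  obtain y a where "e = (y, a)" by (cases e)
  with p pe have "p = (x, a) # p'" "(x, a) \<in> parcs G" by (auto simp: apath_Cons_iff)
  then show thesis using p that by (auto simp: oriented_towards_def)
qed

text \<open>
  Either the path from \<open>a\<close> to the root misses \<open>b\<close>, and prefixing it with \<open>(b, a)\<close> gives the path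
  from \<open>b\<close>; or it passes through \<open>b\<close>, and then it must go there directly, since its part between
  its first step and \<open>b\<close> avoids \<open>a\<close>.
\<close>
lemma (in pair_graph) oriented_towards_total:
  assumes tree: "undirected_tree G" and r: "r \<in> pverts G" and ab: "(a, b) \<in> parcs G"
  shows "(a, b) \<in> oriented_towards r G \<or> (b, a) \<in> oriented_towards r G"
proof -
  have ba: "(b, a) \<in> parcs G" using ab by (rule arcs_symmetric)
  obtain p where p: "apath a p r"
    using tree_apath_exists[OF tree _ r] in_arcsD1[OF ab] by blast
  show ?thesis
  proof (cases "b \<in> set (awalk_verts a p)")
    case False
    then have "apath b ((b, a) # p) r" using p ba by (simp add: apath_Cons_iff)
    then show ?thesis using ba by (auto simp: oriented_towards_def)
  next
    case True
    have "a \<noteq> b" using no_loops'[OF ab] .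
    with True obtain e p' where pe: "p = e # p'" by (cases p) auto
    obtain y c where "e = (y, c)" by (cases e)
    with p pe have p_eq: "p = (a, c) # p'" and ac: "(a, c) \<in> parcs G"
      and p': "awalk c p' r" and a: "a \<notin> set (awalk_verts c p')"
      by (auto simp: apath_Cons_iff awalkI_apath)
    have "b \<in> set (awalk_verts c p')" using True p_eq \<open>a \<noteq> b\<close> by auto
    then obtain s t where "p' = s @ t" and s: "awalk c s b" and t: "awalk b t r"
      using awalk_decomp[OF p'] by blast
    then have "a \<notin> set (awalk_verts c s)" using a set_awalk_verts_append[OF s t] by auto
    then have "c = b" using tree_no_bypass[OF tree ac ab _ s] by blast
    then show ?thesis using p p_eq ab by (auto simp: oriented_towards_def)
  qed
qed

text \<open>
  If an edge were oriented both ways, the path from \<open>b\<close> to the root would continue after \<open>(b, a)\<close>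
  as a path from \<open>a\<close> that avoids \<open>b\<close>, against the uniqueness of the first step from \<open>a\<close>.
\<close>
lemma (in pair_graph) oriented_towards_asym:
  assumes tree: "undirected_tree G"
    and ab: "(a, b) \<in> oriented_towards r G"
  shows "(b, a) \<notin> oriented_towards r G"
proof
  assume "(b, a) \<in> oriented_towards r G"
  then obtain q where "apath b ((b, a) # q) r" by (auto simp: oriented_towards_def)
  then have q: "apath a q r" and bq: "b \<notin> set (awalk_verts a q)" by (auto simp: apath_Cons_iff)
  obtain p where "apath a ((a, b) # p) r" using ab by (auto simp: oriented_towards_def)
  then have "a \<noteq> r" using apath_nonempty_ends by blast
  with q obtain e q' where qe: "q = e # q'" by (cases q) (auto simp: apath_Nil_iff)
  obtain y c where "e = (y, c)" by (cases e)
  with q qe have q_eq: "q = (a, c) # q'" and ac: "(a, c) \<in> parcs G" and q': "apath c q' r"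
    by (auto simp: apath_Cons_iff)
  have "(a, c) \<in> oriented_towards r G" using q q_eq ac by (auto simp: oriented_towards_def)
  then have "c = b" using oriented_towards_unique_head[OF tree ab] by simp
  then show False using bq q_eq hd_in_awalk_verts(2)[OF q'] by auto
qed

lemma (in pair_graph) degree_eq_Suc_in_edges:
  assumes tree: "undirected_tree G" and x: "x \<in> pverts G" and r: "r \<in> pverts G" and "x \<noteq> r"
  shows "degree G x = Suc (card {y. (y, x) \<in> oriented_towards r G})"
proof -
  let ?I = "{y. (y, x) \<in> oriented_towards r G}"
  obtain a where a: "(x, a) \<in> oriented_towards r G"
    using oriented_towards_exists_head[OF assms] .
  have arc: "(u, v) \<in> parcs G" if "(u, v) \<in> oriented_towards r G" for u v
    using that by (auto simp: oriented_towards_def)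
  have nbrs: "{y. (x, y) \<in> parcs G} = insert a ?I"
    using oriented_towards_total[OF tree r] oriented_towards_unique_head[OF tree a] a arc
      arcs_symmetric by blast
  have "a \<notin> ?I" using oriented_towards_asym[OF tree a] by simp
  have fin: "finite ?I"
    by (rule finite_subset[OF _ pair_finite_verts]) (auto dest: arc in_arcsD1)
  have "out_arcs G x = Pair x ` {y. (x, y) \<in> parcs G}" by (auto simp: out_arcs_def)
  then have "degree G x = card {y. (x, y) \<in> parcs G}"
    by (simp add: degree_def out_degree_def card_image inj_on_def)
  then show ?thesis using nbrs \<open>a \<notin> ?I\<close> fin by simp
qed

lemma degree_hyperedge_eq_Suc_burning:
  assumes T: "undirected_spanning_tree T (incidence_graph V E)"
    and "q \<in> V" and "e \<in> E"
  shows "degree T (Inl e) = Suc (card {v. (Inr v, Inl e) \<in> oriented_towards (Inr q) T})"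
proof -
  have tree: "undirected_tree T" and verts: "pverts T = Inl ` E \<union> Inr ` V"
    and arcs: "parcs T \<subseteq> parcs (incidence_graph V E)"
    using T by (auto simp: undirected_spanning_tree_def spanning_def subgraph_def
        incidence_graph_def with_proj_def)
  interpret pair_graph T using tree by (simp add: undirected_tree_def)
  let ?O = "oriented_towards (Inr q) T"
  have "{y. (y, Inl e) \<in> ?O} = Inr ` {v. (Inr v, Inl e) \<in> ?O}"
    using arcs by (fastforce simp: oriented_towards_def incidence_graph_def)
  then have "card {y. (y, Inl e) \<in> ?O} = card {v. (Inr v, Inl e) \<in> ?O}"
    by (simp add: card_image)
  then show ?thesis
    using degree_eq_Suc_in_edges[OF tree, of "Inl e" "Inr q"] verts assms(2,3) by auto
qed

theorem proposition4p10:
  fixes V :: "'v set" and E :: "'v set set" and q :: 'v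
    and T T' :: "('v set + 'v) pair_pre_digraph"
  assumes "connected_hypergraph V E"
    and "q \<in> V"
    and "undirected_spanning_tree T (incidence_graph V E)"
    and "undirected_spanning_tree T' (incidence_graph V E)"
    and "burning_equivalent q T T'"
  shows "hypertree V E (induced_hypertree E T) \<and>
         induced_hypertree E T = induced_hypertree E T'"
proof
  note deg = degree_hyperedge_eq_Suc_burning[OF assms(3,2)]
  note deg' = degree_hyperedge_eq_Suc_burning[OF assms(4,2)]
  have "\<forall>e\<in>E. degree T (Inl e) = induced_hypertree E T e + 1"
    by (simp add: induced_hypertree_def deg)
  then show "hypertree V E (induced_hypertree E T)"
    unfolding hypertree_def using assms(3) by (auto simp: induced_hypertree_def)
  have "{v. (Inr v, Inl e) \<in> oriented_towards (Inr q) T} =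
        {v. (Inr v, Inl e) \<in> oriented_towards (Inr q) T'}" for e
    using assms(5) by (auto simp: burning_equivalent_def set_eq_iff)
  then show "induced_hypertree E T = induced_hypertree E T'"
    unfolding induced_hypertree_def by (auto simp: deg deg' intro!: restrict_ext)
qed

end
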